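(* Let $A\in\mathbb{R}^{m\times n}$ and $b\in\mathbb{R}^m$ be such that $\mathcal{X}:=\{x\in\{0,1\}^n:Ax\le b\}$ is nonempty and $\mathrm{conv}(\mathcal{X})=\{x\in\mathbb{R}^n:Ax\le b\}$. Let $D\in\mathbb{R}^{q\times p}$ and $g\in\mathbb{R}^q$ be such that $\mathcal{U}:=\{\theta\in\mathbb{R}^p:D\theta\ge g\}$ is nonempty and bounded. Let $U,L\in\mathbb{R}^{n\times p}$, $\mu,\lambda\in\mathbb{R}$, and $\eta\in\mathbb{R}$. Suppose that $x^{\top}L\theta+\lambda>0$ for all $x\in\mathcal{X}$ and $\theta\in\mathcal{U}$, that $$\mathcal{U}_\eta:=\Big\{\theta\in\mathcal{U}:\max_{x\in\mathcal{X}}\frac{x^{\top}U\theta+\mu}{x^{\top}L\theta+\lambda}\le\eta\Big\}$$ is nonempty, and that the value of $\max_{x\in\mathcal{X}}\min_{\theta\in\mathcal{U}_\eta}\frac{x^{\top}U\theta+\mu}{x^{\top}L\theta+\lambda}$ lies in $[\underline t,\bar t]$, where $0\le\underline t\le\bar t$. Then $$\max_{x\in\mathcal{X}}\min_{\theta\in\mathcal{U}_\eta}\frac{x^{\top}U\theta+\mu}{x^{\top}L\theta+\lambda}$$ is equal to the optimal value of the mixed-integer linear program $$\begin{aligned}\underset{x\in\{0,1\}^n,\ t\in\mathbb{R},\ \psi\in\mathbb{R}^q,\ y\in\mathbb{R}^n,\ \sigma\in\mathbb{R},\ z\in\mathbb{R}^n}{\text{maximize}}\quad & t\\ \text{subject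 to}\quad & t\lambda-\mu\le g^{\top}\psi-(\eta\lambda-\mu)\sigma,\\ & D^{\top}\psi-(U-\eta L)^{\top}y=U^{\top}x-L^{\top}z,\\ & \underline t\le t\le\bar t,\\ & \underline t\,x_i\le z_i\le\bar t\,x_i\quad\forall i\in\{1,\ldots,n\},\\ & t-\bar t(1-x_i)\le z_i\le t-\underline t(1-x_i)\quad\forall i\in\{1,\ldots,n\},\\ & Ax\le b,\\ & Ay\le b\,\sigma,\\ & \psi\ge 0,\ \sigma\ge 0.\end{aligned}$$
   Context: $\mathrm{conv}$ denotes the convex hull and inequalities between vectors are componentwise. $U$ and $L$ are matrices; $\mathcal{U}$ is the uncertainty set. *)

theory Defs
  imports "HOL-Analysis.Analysis"
begin

definition binary_points :: "real ^ 'n ^ 'm \<Rightarrow> real ^ 'm \<Rightarrow> (real ^ 'n) set" where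
  "binary_points A b = {x. (\<forall>i. x $ i \<in> {0, 1}) \<and> A *v x \<le> b}"

definition uncertainty_set :: "real ^ 'p ^ 'q \<Rightarrow> real ^ 'q \<Rightarrow> (real ^ 'p) set" where
  "uncertainty_set D g = {\<theta>. D *v \<theta> \<ge> g}"

definition ratio ::
  "real ^ 'p ^ 'n \<Rightarrow> real ^ 'p ^ 'n \<Rightarrow> real \<Rightarrow> real \<Rightarrow> real ^ 'n \<Rightarrow> real ^ 'p \<Rightarrow> real" where
  "ratio U L \<mu> lam x \<theta> = (x \<bullet> (U *v \<theta>) + \<mu>) / (x \<bullet> (L *v \<theta>) + lam)"

(* Max is the library's maximum of a finite set; it is used below only for X finite and nonempty. *)
definition restricted_set ::
  "(real ^ 'n) set \<Rightarrow> (real ^ 'p) set \<Rightarrow> (real ^ 'n \<Rightarrow> real ^ 'p \<Rightarrow> real) \<Rightarrow> real \<Rightarrow> (real ^ 'p) set" where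
  "restricted_set X \<Theta> r \<eta> = {\<theta> \<in> \<Theta>. Max ((\<lambda>x. r x \<theta>) ` X) \<le> \<eta>}"

(* The inner minimum is written as an infimum over a possibly infinite set; that it is a
   minimum has to be asserted separately. *)
definition max_min_value ::
  "(real ^ 'n) set \<Rightarrow> (real ^ 'p) set \<Rightarrow> (real ^ 'n \<Rightarrow> real ^ 'p \<Rightarrow> real) \<Rightarrow> real" where
  "max_min_value X \<Theta> r = Max ((\<lambda>x. INF \<theta>\<in>\<Theta>. r x \<theta>) ` X)"

definition attains_min :: "('a \<Rightarrow> real) \<Rightarrow> 'a set \<Rightarrow> bool" where
  "attains_min f S \<longleftrightarrow> (\<exists>s\<in>S. \<forall>s'\<in>S. f s \<le> f s')"

(* The value v of "maximize f over S", which includes that the maximum is attained. *)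
definition is_optimal_max_value :: "('a \<Rightarrow> real) \<Rightarrow> 'a set \<Rightarrow> real \<Rightarrow> bool" where
  "is_optimal_max_value f S v \<longleftrightarrow> (\<exists>s\<in>S. f s = v) \<and> (\<forall>s\<in>S. f s \<le> v)"

definition milp_feasible ::
  "real ^ 'n ^ 'm \<Rightarrow> real ^ 'm \<Rightarrow> real ^ 'p ^ 'q \<Rightarrow> real ^ 'q \<Rightarrow>
   real ^ 'p ^ 'n \<Rightarrow> real ^ 'p ^ 'n \<Rightarrow> real \<Rightarrow> real \<Rightarrow> real \<Rightarrow> real \<Rightarrow> real \<Rightarrow>
   ((real ^ 'n) \<times> real \<times> (real ^ 'q) \<times> (real ^ 'n) \<times> real \<times> (real ^ 'n)) set" where
  "milp_feasible A b D g U L \<mu> lam \<eta> t_lo t_hi =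
    {(x, t, \<psi>, y, \<sigma>, z).
       (\<forall>i. x $ i \<in> {0, 1}) \<and>
       t * lam - \<mu> \<le> g \<bullet> \<psi> - (\<eta> * lam - \<mu>) * \<sigma> \<and>
       transpose D *v \<psi> - transpose (U - \<eta> *\<^sub>R L) *v y = transpose U *v x - transpose L *v z \<and>
       t_lo \<le> t \<and> t \<le> t_hi \<and>
       (\<forall>i. t_lo * x $ i \<le> z $ i \<and> z $ i \<le> t_hi * x $ i) \<and>
       (\<forall>i. t - t_hi * (1 - x $ i) \<le> z $ i \<and> z $ i \<le> t - t_lo * (1 - x $ i)) \<and>
       A *v x \<le> b \<and>
       A *v y \<le> \<sigma> *\<^sub>R b \<and>
       0 \<le> \<psi> \<and> 0 \<le> \<sigma>}"

end

theory Submission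
  imports Defs
begin

text \<open>Since the denominators are positive, \<open>\<Theta>\<eta>\<close> is the polytope cut out of \<open>\<Theta>\<close> by the linear
  inequalities \<open>x \<bullet> (U - \<eta> L) \<theta> \<le> \<eta> \<lambda> - \<mu>\<close> for \<open>x \<in> X\<close>, and \<open>t \<le> r x \<theta>\<close> is linear in \<open>\<theta>\<close>.
  For fixed \<open>x\<close>, Farkas' lemma certifies \<open>t \<le> r x \<theta>\<close> on \<open>\<Theta>\<eta>\<close> by multipliers \<open>\<psi>\<close> for \<open>\<Theta>\<close> and
  \<open>w x'\<close> for the points \<open>x'\<close> of \<open>X\<close>. The latter enter only through \<open>\<sigma> = \<Sum> w x'\<close> and
  \<open>y = \<Sum> w x' x'\<close>, and the constraint \<open>A y \<le> \<sigma> b\<close> on \<open>(y, \<sigma>)\<close> suffices for weak duality because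
  \<open>conv X = {x. A x \<le> b}\<close>. For binary \<open>x\<close> the bounds on \<open>z\<close> force \<open>z = t x\<close>.\<close>

section \<open>Cone separation, the affine Farkas lemma and homogenization\<close>

lemma nonpos_if_multiples_bounded:
  fixes a b :: real
  assumes "\<And>k. 0 \<le> k \<Longrightarrow> k * a \<le> b"
  shows "a \<le> 0"
proof (rule ccontr)
  assume "\<not> a \<le> 0"
  then have "(\<bar>b\<bar> + 1) / a * a = \<bar>b\<bar> + 1" and "0 \<le> (\<bar>b\<bar> + 1) / a"
    by simp_all
  with assms show False
    by force
qed

text \<open>A finitely generated convex cone is closed, so a hyperplane separates \<open>z\<close>
  from it strictly. Scaling each generator without bound makes \<open>h\<close> nonnegative on it,
  and since 0 lies in the cone the separating threshold is negative.\<close>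

lemma convex_cone_hull_separation:
  fixes S :: "'a::euclidean_space set"
  assumes "finite S" and "z \<notin> convex_cone hull S"
  obtains h where "\<And>x. x \<in> S \<Longrightarrow> 0 \<le> h \<bullet> x" and "h \<bullet> z < 0"
proof -
  let ?K = "convex_cone hull S"
  obtain h e where h: "h \<bullet> z < e" "\<forall>x\<in>?K. e < h \<bullet> x"
    using separating_hyperplane_closed_point[of ?K z] convex_convex_cone_hull[of S]
      closed_convex_cone_hull[OF assms(1)] assms(2) by blast
  have "0 \<le> h \<bullet> x" if "x \<in> S" for x
  proof -
    have "k * (- (h \<bullet> x)) \<le> - e" if "0 \<le> k" for k
    proof -
      have "k *\<^sub>R x \<in> ?K"
        using \<open>x \<in> S\<close> that by (simp add: convex_cone_hull_mul hull_inc)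
      with h(2) show ?thesis
        by fastforce
    qed
    then show ?thesis
      using nonpos_if_multiples_bounded[of "- (h \<bullet> x)" "- e"] by simp
  qed
  moreover have "h \<bullet> z < 0"
    using h convex_cone_hull_contains_0[of S] by fastforce
  ultimately show ?thesis
    using that by blast
qed

text \<open>The affine Farkas lemma is obtained by separating \<open>(c, \<gamma>)\<close> from the cone generated by the
  pairs \<open>(a i, \<beta> i)\<close> and \<open>(0, -1)\<close>. The separating vector \<open>(h, s)\<close> has \<open>s \<le> 0\<close>; it yields the
  violating point \<open>h / (-s)\<close> if \<open>s < 0\<close>, and a recession direction \<open>h\<close> along which
  \<open>c \<bullet> \<theta>\<close> is unbounded below if \<open>s = 0\<close>.\<close>

lemma farkas_affine:
  fixes a :: "'i \<Rightarrow> 'a::euclidean_space" and \<beta> :: "'i \<Rightarrow> real"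
  assumes "finite I"
    and feasible: "\<And>i. i \<in> I \<Longrightarrow> \<beta> i \<le> a i \<bullet> \<theta>\<^sub>0"
    and implied: "\<And>\<theta>. (\<And>i. i \<in> I \<Longrightarrow> \<beta> i \<le> a i \<bullet> \<theta>) \<Longrightarrow> \<gamma> \<le> c \<bullet> \<theta>"
  obtains w where "\<And>i. i \<in> I \<Longrightarrow> 0 \<le> w i"
    and "c = (\<Sum>i\<in>I. w i *\<^sub>R a i)" and "\<gamma> \<le> (\<Sum>i\<in>I. w i * \<beta> i)"
proof -
  let ?S = "insert (0, -1) ((\<lambda>i. (a i, \<beta> i)) ` I)"
  \<comment> \<open>\<open>?T\<close> consists of the pairs certified by nonnegative multipliers;
    the slack in \<open>s\<close> absorbs the generator \<open>(0, -1)\<close>. Only the inclusion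
    of the hull in \<open>?T\<close> is needed to read off multipliers for
    \<open>(c, \<gamma>)\<close>.\<close>
  let ?T = "{(u, s). \<exists>w. (\<forall>i\<in>I. 0 \<le> w i) \<and> u = (\<Sum>i\<in>I. w i *\<^sub>R a i) \<and> s \<le> (\<Sum>i\<in>I. w i * \<beta> i)}"
  have "?S \<subseteq> ?T"
  proof -
    have "(0, -1) \<in> ?T"
      by (auto intro!: exI[of _ "\<lambda>_. 0"])
    moreover have "(a i, \<beta> i) \<in> ?T" if "i \<in> I" for i
      using that \<open>finite I\<close>
      by (auto intro!: exI[of _ "\<lambda>j. if j = i then 1 else 0"]
          simp: if_distrib[of "\<lambda>r. r *\<^sub>R _"] if_distrib[of "\<lambda>r. r * _"] cong: if_cong)
    ultimately show ?thesis
      by blast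
  qed
  moreover have "convex_cone ?T"
    unfolding convex_cone_iff
  proof (intro conjI ballI allI impI)
    show "0 \<in> ?T"
      by (auto intro!: exI[of _ "\<lambda>_. 0"] simp: zero_prod_def)
  next
    fix x y assume "x \<in> ?T" "y \<in> ?T"
    then obtain w v where "\<forall>i\<in>I. 0 \<le> w i" "fst x = (\<Sum>i\<in>I. w i *\<^sub>R a i)" "snd x \<le> (\<Sum>i\<in>I. w i * \<beta> i)"
      "\<forall>i\<in>I. 0 \<le> v i" "fst y = (\<Sum>i\<in>I. v i *\<^sub>R a i)" "snd y \<le> (\<Sum>i\<in>I. v i * \<beta> i)"
      by auto
    then show "x + y \<in> ?T"
      by (auto intro!: exI[of _ "\<lambda>i. w i + v i"]
          simp: plus_prod_def algebra_simps sum.distrib)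
  next
    fix x and k :: real assume "x \<in> ?T" "0 \<le> k"
    then obtain w where "\<forall>i\<in>I. 0 \<le> w i" "fst x = (\<Sum>i\<in>I. w i *\<^sub>R a i)" "snd x \<le> (\<Sum>i\<in>I. w i * \<beta> i)"
      by auto
    with \<open>0 \<le> k\<close> show "k *\<^sub>R x \<in> ?T"
      by (auto intro!: exI[of _ "\<lambda>i. k * w i"] mult_left_mono
          simp: scaleR_prod_def scaleR_sum_right mult.assoc simp flip: sum_distrib_left)
  qed
  ultimately have sub: "convex_cone hull ?S \<subseteq> ?T"
    by (rule hull_minimal)
  have "(c, \<gamma>) \<in> convex_cone hull ?S"
  proof (rule ccontr)
    assume "(c, \<gamma>) \<notin> convex_cone hull ?S"
    then obtain p where p: "\<And>x. x \<in> ?S \<Longrightarrow> 0 \<le> p \<bullet> x" "p \<bullet> (c, \<gamma>) < 0"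
      using convex_cone_hull_separation[of ?S "(c, \<gamma>)"] \<open>finite I\<close> by blast
    obtain h s where hs: "p = (h, s)"
      by force
    have "s \<le> 0"
      using p(1)[of "(0, -1)"] by (simp add: hs)
    have gen: "0 \<le> a i \<bullet> h + \<beta> i * s" if "i \<in> I" for i
      using p(1)[of "(a i, \<beta> i)"] that by (simp add: hs inner_commute mult.commute)
    have neg: "c \<bullet> h + \<gamma> * s < 0"
      using p(2) by (simp add: hs inner_commute mult.commute)
    show False
    proof (cases "s = 0")
      case True
      have "k * (- (c \<bullet> h)) \<le> c \<bullet> \<theta>\<^sub>0 - \<gamma>" if "0 \<le> k" for k
      proof -
        have "\<gamma> \<le> c \<bullet> (\<theta>\<^sub>0 + k *\<^sub>R h)"
        proof (rule implied)
          fix i assume "i \<in> I"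
          then have "0 \<le> k * (a i \<bullet> h)"
            using gen[of i] True that by simp
          with feasible[OF \<open>i \<in> I\<close>] show "\<beta> i \<le> a i \<bullet> (\<theta>\<^sub>0 + k *\<^sub>R h)"
            by (simp add: inner_add_right)
        qed
        then show ?thesis
          by (simp add: inner_add_right)
      qed
      then have "- (c \<bullet> h) \<le> 0"
        by (rule nonpos_if_multiples_bounded)
      with neg True show False
        by simp
    next
      case False
      with \<open>s \<le> 0\<close> have "s < 0"
        by simp
      have "\<gamma> \<le> c \<bullet> (h /\<^sub>R (- s))"
      proof (rule implied)
        fix i assume "i \<in> I"
        with gen[of i] \<open>s < 0\<close> show "\<beta> i \<le> a i \<bullet> (h /\<^sub>R (- s))"
          by (simp add: field_simps)
      qed
      with neg \<open>s < 0\<close> show False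
        by (simp add: field_simps)
    qed
  qed
  with sub have "(c, \<gamma>) \<in> ?T"
    by blast
  then show ?thesis
    using that by auto
qed

text \<open>The bound at \<open>(x\<^sub>0 + k y) / (1 + k \<sigma>)\<close> for all \<open>k \<ge> 0\<close> covers \<open>\<sigma> = 0\<close> and
  \<open>\<sigma> > 0\<close> at once.\<close>

lemma homogenized_bound:
  fixes A :: "real ^ 'n ^ 'm"
  assumes bound: "\<And>x. A *v x \<le> b \<Longrightarrow> x \<bullet> c \<le> d"
    and "A *v x\<^sub>0 \<le> b" and "0 \<le> \<sigma>" and "A *v y \<le> \<sigma> *\<^sub>R b"
  shows "y \<bullet> c \<le> \<sigma> * d"
proof -
  have "k * (y \<bullet> c - \<sigma> * d) \<le> d - x\<^sub>0 \<bullet> c" if "0 \<le> k" for k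
  proof -
    have pos: "0 < 1 + k * \<sigma>"
      using that \<open>0 \<le> \<sigma>\<close> by (simp add: add_pos_nonneg)
    let ?x = "(x\<^sub>0 + k *\<^sub>R y) /\<^sub>R (1 + k * \<sigma>)"
    have "A *v (x\<^sub>0 + k *\<^sub>R y) \<le> (1 + k * \<sigma>) *\<^sub>R b"
      using add_mono[OF assms(2) scaleR_left_mono[OF assms(4) that]]
      by (simp add: algebra_simps)
    then have "(A *v (x\<^sub>0 + k *\<^sub>R y)) /\<^sub>R (1 + k * \<sigma>) \<le> ((1 + k * \<sigma>) *\<^sub>R b) /\<^sub>R (1 + k * \<sigma>)"
      by (rule scaleR_left_mono) (use pos in simp)
    then have "A *v ?x \<le> b"
      using pos by (simp add: matrix_vector_mult_scaleR)
    then have "?x \<bullet> c \<le> d"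
      by (rule bound)
    then have "(x\<^sub>0 + k *\<^sub>R y) \<bullet> c \<le> d * (1 + k * \<sigma>)"
      using pos by (simp add: pos_divide_le_eq flip: divide_inverse_commute)
    then show ?thesis
      by (simp add: inner_add_left algebra_simps)
  qed
  then have "y \<bullet> c - \<sigma> * d \<le> 0"
    by (rule nonpos_if_multiples_bounded)
  then show ?thesis
    by simp
qed

section \<open>Binary points and linear forms of the fractional constraints\<close>

lemma finite_binary_points: "finite (binary_points A b)"
proof (rule finite_subset)
  show "binary_points A b \<subseteq> range (\<lambda>S. \<chi> i. if i \<in> S then 1 else 0)"
  proof
    fix x assume "x \<in> binary_points A b"
    then have "x = (\<chi> i. if i \<in> {i. x $ i = 1} then 1 else 0)"
      by (auto simp: binary_points_def vec_eq_iff)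
    then show "x \<in> range (\<lambda>S. \<chi> i. if i \<in> S then 1 else 0)"
      by blast
  qed
qed simp

text \<open>The product of \<open>t\<close> with the \<open>L\<close> term stays separate, to be
  matched with \<open>z = t x\<close> in the program. The next lemma merges it into one matrix, as
  the threshold there will be the constant \<eta>.\<close>

lemma ratio_ge_iff:
  assumes "0 < x \<bullet> (L *v \<theta>) + lam"
  shows "t \<le> ratio U L \<mu> lam x \<theta> \<longleftrightarrow> t * lam - \<mu> \<le> x \<bullet> (U *v \<theta>) - t * (x \<bullet> (L *v \<theta>))"
  using assms by (simp add: ratio_def pos_le_divide_eq algebra_simps)

lemma ratio_le_iff:
  assumes "0 < x \<bullet> (L *v \<theta>) + lam"
  shows "ratio U L \<mu> lam x \<theta> \<le> t \<longleftrightarrow> x \<bullet> ((U - t *\<^sub>R L) *v \<theta>) \<le> t * lam - \<mu>"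
  using assms
  by (auto simp: ratio_def pos_divide_le_eq algebra_simps scaleR_matrix_vector_assoc[symmetric])

lemma restricted_set_ratio_eq:
  assumes "finite X" and "X \<noteq> {}"
    and "\<And>x \<theta>. x \<in> X \<Longrightarrow> \<theta> \<in> \<Theta> \<Longrightarrow> 0 < x \<bullet> (L *v \<theta>) + lam"
  shows "restricted_set X \<Theta> (ratio U L \<mu> lam) \<eta> =
    {\<theta> \<in> \<Theta>. \<forall>x\<in>X. x \<bullet> ((U - \<eta> *\<^sub>R L) *v \<theta>) \<le> \<eta> * lam - \<mu>}"
  using assms by (auto simp: restricted_set_def ratio_le_iff)

lemma closed_uncertainty_set: "closed (uncertainty_set D g)"
  unfolding uncertainty_set_def less_eq_vec_def
  by (intro closed_Collect_all closed_Collect_le continuous_intros)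

section \<open>Duality on the restricted set and values of the max-min problem\<close>

lemma farkas_restricted_set:
  fixes D :: "real ^ 'p ^ 'q" and M :: "real ^ 'p ^ 'n"
  assumes "finite X" and "g \<le> D *v \<theta>\<^sub>0" and "\<And>x. x \<in> X \<Longrightarrow> x \<bullet> (M *v \<theta>\<^sub>0) \<le> d"
    and implied: "\<And>\<theta>. g \<le> D *v \<theta> \<Longrightarrow> (\<And>x. x \<in> X \<Longrightarrow> x \<bullet> (M *v \<theta>) \<le> d) \<Longrightarrow> \<gamma> \<le> c \<bullet> \<theta>"
  obtains \<psi> w where "0 \<le> \<psi>" and "\<And>x. x \<in> X \<Longrightarrow> 0 \<le> w x"
    and "c = \<psi> v* D - (\<Sum>x\<in>X. w x *\<^sub>R x) v* M"
    and "\<gamma> \<le> g \<bullet> \<psi> - d * (\<Sum>x\<in>X. w x)"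
proof -
  \<comment> \<open>The index set is the disjoint sum of the rows of \<open>D\<close> and the points
    of \<open>X\<close>. Constraints from \<open>X\<close> are upper bounds, so they enter with
    reversed sign.\<close>
  let ?I = "(UNIV :: 'q set) <+> X"
  let ?a = "case_sum (\<lambda>j. D $ j) (\<lambda>x. - (x v* M))"
  let ?\<beta> = "case_sum (\<lambda>j. g $ j) (\<lambda>_. - d)"
  have iff: "(\<forall>i\<in>?I. ?\<beta> i \<le> ?a i \<bullet> \<theta>) \<longleftrightarrow> g \<le> D *v \<theta> \<and> (\<forall>x\<in>X. x \<bullet> (M *v \<theta>) \<le> d)" for \<theta>
    by (simp add: Plus_def ball_Un less_eq_vec_def matrix_vector_mul_component dot_lmul_matrix)
  obtain w where w: "\<And>i. i \<in> ?I \<Longrightarrow> 0 \<le> w i"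
    and c: "c = (\<Sum>i\<in>?I. w i *\<^sub>R ?a i)" and \<gamma>: "\<gamma> \<le> (\<Sum>i\<in>?I. w i * ?\<beta> i)"
  proof (rule farkas_affine[of ?I ?\<beta> ?a \<theta>\<^sub>0 \<gamma> c])
    show "finite ?I"
      using \<open>finite X\<close> by simp
    show "?\<beta> i \<le> ?a i \<bullet> \<theta>\<^sub>0" if "i \<in> ?I" for i
      using that iff[of \<theta>\<^sub>0] assms(2,3) by blast
    show "\<gamma> \<le> c \<bullet> \<theta>" if "\<And>i. i \<in> ?I \<Longrightarrow> ?\<beta> i \<le> ?a i \<bullet> \<theta>" for \<theta>
      using that iff[of \<theta>] implied[of \<theta>] by blast
  qed blast
  let ?\<psi> = "\<chi> j. w (Inl j)"
  show ?thesis
  proof (rule that[of ?\<psi> "w \<circ> Inr"])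
    show "0 \<le> ?\<psi>"
      using w by (auto simp: less_eq_vec_def)
    show "0 \<le> (w \<circ> Inr) x" if "x \<in> X" for x
      using w that by auto
    show "c = ?\<psi> v* D - (\<Sum>x\<in>X. (w \<circ> Inr) x *\<^sub>R x) v* M"
    \<comment> \<open>Testing against every \<theta> turns the vector identity into inner products,
      where \<open>dot_lmul_matrix\<close> moves the matrices across.\<close>
    proof (rule vector_eq_rdot[THEN iffD1], intro allI)
      fix \<theta>
      have "c \<bullet> \<theta> = (\<Sum>j\<in>UNIV. w (Inl j) * (D *v \<theta>) $ j) - (\<Sum>x\<in>X. w (Inr x) * (x \<bullet> (M *v \<theta>)))"
        using \<open>finite X\<close>
        by (simp add: c sum.Plus inner_add_left inner_sum_left matrix_vector_mul_component
            dot_lmul_matrix sum_negf inner_diff_left)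
      also have "\<dots> = (?\<psi> v* D - (\<Sum>x\<in>X. (w \<circ> Inr) x *\<^sub>R x) v* M) \<bullet> \<theta>"
        by (simp add: inner_diff_left dot_lmul_matrix inner_sum_left)
          (simp add: inner_vec_def)
      finally show "c \<bullet> \<theta> = (?\<psi> v* D - (\<Sum>x\<in>X. (w \<circ> Inr) x *\<^sub>R x) v* M) \<bullet> \<theta>" .
    qed
    show "\<gamma> \<le> g \<bullet> ?\<psi> - d * (\<Sum>x\<in>X. (w \<circ> Inr) x)"
      using \<gamma> \<open>finite X\<close>
      by (simp add: sum.Plus inner_vec_def sum_negf sum_distrib_left mult.commute)
  qed
qed

lemma max_min_value_attained:
  assumes "finite X" and "X \<noteq> {}"
  obtains x where "x \<in> X" and "max_min_value X \<Theta> r = (INF \<theta>\<in>\<Theta>. r x \<theta>)"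
proof -
  have "max_min_value X \<Theta> r \<in> (\<lambda>x. INF \<theta>\<in>\<Theta>. r x \<theta>) ` X"
    unfolding max_min_value_def using assms by (intro Max_in) simp_all
  then show ?thesis
    using that by blast
qed

lemma le_max_min_value:
  assumes "finite X" and "x \<in> X" and "\<Theta> \<noteq> {}" and "\<And>\<theta>. \<theta> \<in> \<Theta> \<Longrightarrow> t \<le> r x \<theta>"
  shows "t \<le> max_min_value X \<Theta> r"
proof -
  have "t \<le> (INF \<theta>\<in>\<Theta>. r x \<theta>)"
    using assms(3,4) by (rule cINF_greatest)
  also have "\<dots> \<le> max_min_value X \<Theta> r"
    using assms(1,2) by (simp add: max_min_value_def)
  finally show ?thesis .
qed

text \<open>Conic combinations preserve linear inequalities; this makes the aggregated multipliers
  satisfy the constraint on \<open>(y, \<sigma>)\<close>.\<close>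

lemma matrix_vector_mult_sum_le:
  fixes A :: "real ^ 'n ^ 'm"
  assumes "\<And>x. x \<in> X \<Longrightarrow> A *v x \<le> b" and "\<And>x. x \<in> X \<Longrightarrow> 0 \<le> w x"
  shows "A *v (\<Sum>x\<in>X. w x *\<^sub>R x) \<le> (\<Sum>x\<in>X. w x) *\<^sub>R b"
proof -
  have "A *v (\<Sum>x\<in>X. w x *\<^sub>R x) = (\<Sum>x\<in>X. w x *\<^sub>R (A *v x))"
    by (simp add: linear_sum[OF matrix_vector_mul_linear] matrix_vector_mult_scaleR)
  also have "\<dots> \<le> (\<Sum>x\<in>X. w x *\<^sub>R b)"
    using assms by (intro sum_mono scaleR_left_mono)
  finally show ?thesis
    by (simp add: scaleR_sum_left)
qed

section \<open>Attained inner minima, weak duality and an optimal feasible point\<close>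

theorem proposition7:
  fixes A :: "real ^ 'n ^ 'm" and b :: "real ^ 'm"
    and D :: "real ^ 'p ^ 'q" and g :: "real ^ 'q"
    and U L :: "real ^ 'p ^ 'n"
    and \<mu> lam \<eta> t_lo t_hi :: real
  defines "X \<equiv> binary_points A b"
    and "\<Theta> \<equiv> uncertainty_set D g"
    and "r \<equiv> ratio U L \<mu> lam"
  defines "\<Theta>\<eta> \<equiv> restricted_set X \<Theta> r \<eta>"
  assumes "X \<noteq> {}"
    and "convex hull X = {x. A *v x \<le> b}"
    and "\<Theta> \<noteq> {}" and "bounded \<Theta>"
    and "\<And>x \<theta>. x \<in> X \<Longrightarrow> \<theta> \<in> \<Theta> \<Longrightarrow> x \<bullet> (L *v \<theta>) + lam > 0"
    and "\<Theta>\<eta> \<noteq> {}"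
    and "0 \<le> t_lo" and "t_lo \<le> t_hi"
    and "max_min_value X \<Theta>\<eta> r \<in> {t_lo..t_hi}"
  shows "(\<forall>x\<in>X. attains_min (r x) \<Theta>\<eta>) \<and>
    is_optimal_max_value (\<lambda>(x, t, \<psi>, y, \<sigma>, z). t)
      (milp_feasible A b D g U L \<mu> lam \<eta> t_lo t_hi)
      (max_min_value X \<Theta>\<eta> r)"
proof -
  define M where "M = U - \<eta> *\<^sub>R L"
  define d where "d = \<eta> * lam - \<mu>"
  have fin: "finite X"
    unfolding X_def by (rule finite_binary_points)
  have pos: "0 < x \<bullet> (L *v \<theta>) + lam" if "x \<in> X" "\<theta> \<in> \<Theta>" for x \<theta>
    using assms(9) that by blast
  have restricted: "\<Theta>\<eta> = {\<theta> \<in> \<Theta>. \<forall>x\<in>X. x \<bullet> (M *v \<theta>) \<le> d}"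
    unfolding \<Theta>\<eta>_def r_def M_def d_def
    using fin \<open>X \<noteq> {}\<close> pos by (rule restricted_set_ratio_eq)
  have "compact \<Theta>\<eta>"
  proof -
    have "closed {\<theta>. \<forall>x. x \<in> X \<longrightarrow> x \<bullet> (M *v \<theta>) \<le> d}"
      by (intro closed_Collect_all closed_Collect_imp closed_Collect_le open_Collect_const
          continuous_intros matrix_vector_mult_linear_continuous_on)
    moreover have "\<Theta>\<eta> = \<Theta> \<inter> {\<theta>. \<forall>x. x \<in> X \<longrightarrow> x \<bullet> (M *v \<theta>) \<le> d}"
      by (auto simp: restricted)
    ultimately show ?thesis
      using \<open>bounded \<Theta>\<close> closed_uncertainty_set[of D g]
      by (simp add: compact_eq_bounded_closed closed_Int bounded_Int \<Theta>_def)
  qed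
  have attained: "attains_min (r x) \<Theta>\<eta>" if "x \<in> X" for x
  proof -
    have "continuous_on \<Theta>\<eta> (r x)"
      unfolding r_def ratio_def
      by (intro continuous_intros matrix_vector_mult_linear_continuous_on)
        (use pos[OF that] in \<open>fastforce simp: restricted\<close>)
    then show ?thesis
      using continuous_attains_inf[OF \<open>compact \<Theta>\<eta>\<close> \<open>\<Theta>\<eta> \<noteq> {}\<close>]
      by (simp add: attains_min_def)
  qed
  let ?v = "max_min_value X \<Theta>\<eta> r"
  have upper: "t \<le> ?v" if feas: "(x, t, \<psi>, y, \<sigma>, z) \<in> milp_feasible A b D g U L \<mu> lam \<eta> t_lo t_hi"
    for x t \<psi> y \<sigma> z
  proof (rule le_max_min_value[OF fin _ \<open>\<Theta>\<eta> \<noteq> {}\<close>])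
    have x: "\<forall>i. x $ i \<in> {0, 1}" and obj: "t * lam - \<mu> \<le> g \<bullet> \<psi> - d * \<sigma>"
      and dual: "\<psi> v* D - y v* M = x v* U - z v* L"
      and z: "\<forall>i. t_lo * x $ i \<le> z $ i \<and> z $ i \<le> t_hi * x $ i"
        "\<forall>i. t - t_hi * (1 - x $ i) \<le> z $ i \<and> z $ i \<le> t - t_lo * (1 - x $ i)"
      and y: "A *v x \<le> b" "A *v y \<le> \<sigma> *\<^sub>R b" "0 \<le> \<psi>" "0 \<le> \<sigma>"
      using feas by (simp_all add: milp_feasible_def M_def d_def)
    show "x \<in> X"
      using x y(1) by (simp add: X_def binary_points_def)
    \<comment> \<open>If \<open>x $ i = 0\<close>, the first pair of bounds pins
      \<open>z $ i\<close> to 0; if \<open>x $ i = 1\<close>, the second pins it to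
      \<open>t\<close>.\<close>
    have "z $ i = t * x $ i" for i
      using x[rule_format, of i] z[rule_format, of i] by auto
    then have "z = t *\<^sub>R x"
      by (simp add: vec_eq_iff)
    fix \<theta> assume \<theta>: "\<theta> \<in> \<Theta>\<eta>"
    then have "\<theta> \<in> \<Theta>" and "g \<le> D *v \<theta>"
      by (simp_all add: restricted \<Theta>_def uncertainty_set_def)
    \<comment> \<open>The half-space contains \<open>X\<close>, hence its hull, hence also the
      fractional solutions of \<open>A *v x \<le> b\<close>. This matters because \<open>y\<close>
      need not be a multiple of a binary point.\<close>
    have "convex {x. x \<bullet> (M *v \<theta>) \<le> d}"
      using convex_halfspace_le[of "M *v \<theta>" d] by (simp add: inner_commute)
    then have "convex hull X \<subseteq> {x. x \<bullet> (M *v \<theta>) \<le> d}"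
      using \<theta> by (intro hull_minimal) (auto simp: restricted)
    then have "x \<bullet> (M *v \<theta>) \<le> d" if "A *v x \<le> b" for x
      using that \<open>convex hull X = {x. A *v x \<le> b}\<close> by blast
    then have "y \<bullet> (M *v \<theta>) \<le> \<sigma> * d"
      using y(1,4,2) by (rule homogenized_bound)
    moreover have "g \<bullet> \<psi> \<le> \<psi> \<bullet> (D *v \<theta>)"
      using \<open>g \<le> D *v \<theta>\<close> \<open>0 \<le> \<psi>\<close>
      by (auto simp: inner_vec_def less_eq_vec_def mult.commute intro!: sum_mono mult_left_mono)
    \<comment> \<open>Weak duality: the dual equation is paired with \<theta>.\<close>
    moreover have "\<psi> \<bullet> (D *v \<theta>) - y \<bullet> (M *v \<theta>) = x \<bullet> (U *v \<theta>) - t * (x \<bullet> (L *v \<theta>))"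
      using arg_cong[OF dual, of "\<lambda>u. u \<bullet> \<theta>"] \<open>z = t *\<^sub>R x\<close>
      by (simp add: inner_diff_left dot_lmul_matrix)
    ultimately show "t \<le> r x \<theta>"
      using obj pos[OF \<open>x \<in> X\<close> \<open>\<theta> \<in> \<Theta>\<close>] by (simp add: r_def ratio_ge_iff mult.commute)
  qed
  have "\<exists>x \<psi> y \<sigma> z. (x, ?v, \<psi>, y, \<sigma>, z) \<in> milp_feasible A b D g U L \<mu> lam \<eta> t_lo t_hi"
  proof -
    obtain x where "x \<in> X" and v: "?v = (INF \<theta>\<in>\<Theta>\<eta>. r x \<theta>)"
      using fin \<open>X \<noteq> {}\<close> by (rule max_min_value_attained)
    have le: "?v \<le> r x \<theta>" if "\<theta> \<in> \<Theta>\<eta>" for \<theta>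
      unfolding v
    proof (rule cINF_lower[OF _ that])
      \<comment> \<open>Without this bound the real infimum could be a junk value; the attained
        minimum supplies it.\<close>
      show "bdd_below (r x ` \<Theta>\<eta>)"
        using attained[OF \<open>x \<in> X\<close>] by (auto simp: attains_min_def intro: bdd_belowI2)
    qed
    obtain \<theta>\<^sub>0 where \<theta>\<^sub>0: "g \<le> D *v \<theta>\<^sub>0" "\<And>x. x \<in> X \<Longrightarrow> x \<bullet> (M *v \<theta>\<^sub>0) \<le> d"
      using \<open>\<Theta>\<eta> \<noteq> {}\<close> by (auto simp: restricted \<Theta>_def uncertainty_set_def)
    \<comment> \<open>For the maximizing \<open>x\<close>, \<open>?v \<le> r x \<theta>\<close> is a
      single linear inequality in \<theta> valid on the whole restricted set, as the Farkas lemma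
      requires.\<close>
    have implied: "?v * lam - \<mu> \<le> (x v* U - (?v *\<^sub>R x) v* L) \<bullet> \<theta>"
      if "g \<le> D *v \<theta>" "\<And>x. x \<in> X \<Longrightarrow> x \<bullet> (M *v \<theta>) \<le> d" for \<theta>
    proof -
      have "\<theta> \<in> \<Theta>" "\<theta> \<in> \<Theta>\<eta>"
        using that by (simp_all add: restricted \<Theta>_def uncertainty_set_def)
      then show ?thesis
        using le[of \<theta>] pos[OF \<open>x \<in> X\<close>, of \<theta>]
        by (simp add: r_def ratio_ge_iff inner_diff_left dot_lmul_matrix)
    qed
    obtain \<psi> w where "0 \<le> \<psi>" and w: "\<And>x. x \<in> X \<Longrightarrow> 0 \<le> w x"
      and dual: "x v* U - (?v *\<^sub>R x) v* L = \<psi> v* D - (\<Sum>x\<in>X. w x *\<^sub>R x) v* M"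
      and obj: "?v * lam - \<mu> \<le> g \<bullet> \<psi> - d * (\<Sum>x\<in>X. w x)"
      using farkas_restricted_set[OF fin \<theta>\<^sub>0 implied] by blast
    have x: "x $ i \<in> {0, 1}" "A *v x \<le> b" for i
      using \<open>x \<in> X\<close> by (simp_all add: X_def binary_points_def)
    have "A *v (\<Sum>x\<in>X. w x *\<^sub>R x) \<le> (\<Sum>x\<in>X. w x) *\<^sub>R b"
      using w by (intro matrix_vector_mult_sum_le) (simp_all add: X_def binary_points_def)
    moreover have "0 \<le> (\<Sum>x\<in>X. w x)"
      using w by (rule sum_nonneg)
    \<comment> \<open>The range assumption on \<open>?v\<close> enters here: through the first pair
      of bounds if \<open>x $ i = 1\<close>, through the second if \<open>x $ i = 0\<close>.\<close>
    moreover have "t_lo * x $ i \<le> ?v * x $ i \<and> ?v * x $ i \<le> t_hi * x $ i \<and>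
        ?v - t_hi * (1 - x $ i) \<le> ?v * x $ i \<and> ?v * x $ i \<le> ?v - t_lo * (1 - x $ i)" for i
      using x(1)[of i] \<open>?v \<in> {t_lo..t_hi}\<close> by auto
    \<comment> \<open>The \<open>x\<close> bound in the two sums ranges over \<open>X\<close> and is
      unrelated to the maximizer in the other components.\<close>
    ultimately have "(x, ?v, \<psi>, \<Sum>x\<in>X. w x *\<^sub>R x, \<Sum>x\<in>X. w x, ?v *\<^sub>R x)
        \<in> milp_feasible A b D g U L \<mu> lam \<eta> t_lo t_hi"
      using x \<open>?v \<in> {t_lo..t_hi}\<close> \<open>0 \<le> \<psi>\<close> dual obj
      by (simp add: milp_feasible_def M_def d_def)
    then show ?thesis
      by blast
  qed
  then have "is_optimal_max_value (\<lambda>(x, t, \<psi>, y, \<sigma>, z). t)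
      (milp_feasible A b D g U L \<mu> lam \<eta> t_lo t_hi) ?v"
    unfolding is_optimal_max_value_def using upper by force
  with attained show ?thesis
    by blast
qed

end
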